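(* Let $\mathcal{E}$ be a topos which is a model of guarded recursive terms. Then the L\"ob induction principle $\forall p:\Omega.\ (\rhd p\to p)\to p$ is valid in the internal logic of $\mathcal{E}$.
   Context: A model of guarded recursive terms: a category with finite products, an endofunctor $\blacktriangleright$ preserving finite limits and a natural transformation $\mathrm{next}:\mathrm{id}\to\blacktriangleright$ such that every $f:\blacktriangleright X\to X$ has a unique $h:1\to X$ with $f\circ\mathrm{next}\circ h=h$. For a subobject $m:M\to X$, $\rhd m$ is the pullback of $\blacktriangleright m:\blacktriangleright M\to\blacktriangleright X$ along $\mathrm{next}_X:X\to\blacktriangleright X$; this gives order-preserving maps $\rhd:\mathrm{Sub}(X)\to\mathrm{Sub}(X)$, natural in $X$, and hence (by Yoneda) a morphism $\rhd:\Omega\to\Omega$ on the subobject classifier. *)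

theory Defs
  imports Main
begin

section \<open>Categories, functors and limits\<close>

record ('o, 'a) category =
  Obj :: "'o set"
  Arr :: "'a set"
  src :: "'a \<Rightarrow> 'o"
  tgt :: "'a \<Rightarrow> 'o"
  idt :: "'o \<Rightarrow> 'a"
  cmp :: "'a \<Rightarrow> 'a \<Rightarrow> 'a"  (infixr \<open>\<cdot>\<index>\<close> 75)

definition Hom :: "('o, 'a, 'r) category_scheme \<Rightarrow> 'o \<Rightarrow> 'o \<Rightarrow> 'a set" where
  "Hom C A B = {f \<in> Arr C. src C f = A \<and> tgt C f = B}"

locale category =
  fixes C :: "('o, 'a, 'r) category_scheme" (structure)
  assumes src_Obj: "f \<in> Arr C \<Longrightarrow> src C f \<in> Obj C"
    and tgt_Obj: "f \<in> Arr C \<Longrightarrow> tgt C f \<in> Obj C"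
    and idt_Hom: "A \<in> Obj C \<Longrightarrow> idt C A \<in> Hom C A A"
    and cmp_Hom: "f \<in> Hom C A B \<Longrightarrow> g \<in> Hom C B D \<Longrightarrow> g \<cdot> f \<in> Hom C A D"
    and cmp_idt: "f \<in> Hom C A B \<Longrightarrow> f \<cdot> idt C A = f"
    and idt_cmp: "f \<in> Hom C A B \<Longrightarrow> idt C B \<cdot> f = f"
    and cmp_assoc: "f \<in> Hom C A B \<Longrightarrow> g \<in> Hom C B D \<Longrightarrow> h \<in> Hom C D D' \<Longrightarrow>
      (h \<cdot> g) \<cdot> f = h \<cdot> (g \<cdot> f)"

definition monic :: "('o, 'a, 'r) category_scheme \<Rightarrow> 'a \<Rightarrow> bool" where
  "monic C m \<longleftrightarrow> m \<in> Arr C \<and>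
    (\<forall>W. \<forall>f\<in>Hom C W (src C m). \<forall>g\<in>Hom C W (src C m).
      m \<cdot>\<^bsub>C\<^esub> f = m \<cdot>\<^bsub>C\<^esub> g \<longrightarrow> f = g)"

locale cat_functor = J: category J + C: category C
  for J :: "('i, 'j, 's) category_scheme"
    and C :: "('o, 'a, 'r) category_scheme"
    and Fo :: "'i \<Rightarrow> 'o" and Fa :: "'j \<Rightarrow> 'a" +
  assumes Fo_Obj: "A \<in> Obj J \<Longrightarrow> Fo A \<in> Obj C"
    and Fa_Hom: "f \<in> Hom J A B \<Longrightarrow> Fa f \<in> Hom C (Fo A) (Fo B)"
    and Fa_idt: "A \<in> Obj J \<Longrightarrow> Fa (idt J A) = idt C (Fo A)"
    and Fa_cmp: "f \<in> Hom J A B \<Longrightarrow> g \<in> Hom J B D \<Longrightarrow>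
      Fa (g \<cdot>\<^bsub>J\<^esub> f) = Fa g \<cdot>\<^bsub>C\<^esub> Fa f"

definition cone ::
  "('i, 'j, 's) category_scheme \<Rightarrow> ('o, 'a, 'r) category_scheme \<Rightarrow>
   ('i \<Rightarrow> 'o) \<Rightarrow> ('j \<Rightarrow> 'a) \<Rightarrow> 'o \<Rightarrow> ('i \<Rightarrow> 'a) \<Rightarrow> bool" where
  "cone J C Do Da V \<sigma> \<longleftrightarrow> V \<in> Obj C \<and>
    (\<forall>i\<in>Obj J. \<sigma> i \<in> Hom C V (Do i)) \<and>
    (\<forall>u\<in>Arr J. Da u \<cdot>\<^bsub>C\<^esub> \<sigma> (src J u) = \<sigma> (tgt J u))"

definition limit_cone ::
  "('i, 'j, 's) category_scheme \<Rightarrow> ('o, 'a, 'r) category_scheme \<Rightarrow>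
   ('i \<Rightarrow> 'o) \<Rightarrow> ('j \<Rightarrow> 'a) \<Rightarrow> 'o \<Rightarrow> ('i \<Rightarrow> 'a) \<Rightarrow> bool" where
  "limit_cone J C Do Da V \<sigma> \<longleftrightarrow> cone J C Do Da V \<sigma> \<and>
    (\<forall>W \<tau>. cone J C Do Da W \<tau> \<longrightarrow>
      (\<exists>!h. h \<in> Hom C W V \<and> (\<forall>i\<in>Obj J. \<sigma> i \<cdot>\<^bsub>C\<^esub> h = \<tau> i)))"

text \<open>Every finite category is isomorphic to one whose objects and arrows are natural
  numbers, so it suffices to let shapes of finite diagrams range over those.\<close>

definition finite_diagram ::
  "(nat, nat) category \<Rightarrow> ('o, 'a, 'r) category_scheme \<Rightarrow>
   (nat \<Rightarrow> 'o) \<Rightarrow> (nat \<Rightarrow> 'a) \<Rightarrow> bool" where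
  "finite_diagram J C Do Da \<longleftrightarrow>
    finite (Obj J) \<and> finite (Arr J) \<and> cat_functor J C Do Da"

definition has_finite_limits :: "('o, 'a, 'r) category_scheme \<Rightarrow> bool" where
  "has_finite_limits C \<longleftrightarrow>
    (\<forall>J Do Da. finite_diagram J C Do Da \<longrightarrow> (\<exists>V \<sigma>. limit_cone J C Do Da V \<sigma>))"

definition preserves_finite_limits ::
  "('o, 'a, 'r) category_scheme \<Rightarrow> ('p, 'b, 's) category_scheme \<Rightarrow>
   ('o \<Rightarrow> 'p) \<Rightarrow> ('a \<Rightarrow> 'b) \<Rightarrow> bool" where
  "preserves_finite_limits C D Fo Fa \<longleftrightarrow>
    (\<forall>J Do Da V \<sigma>. finite_diagram J C Do Da \<longrightarrow> limit_cone J C Do Da V \<sigma> \<longrightarrow>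
      limit_cone J D (Fo \<circ> Do) (Fa \<circ> Da) (Fo V) (Fa \<circ> \<sigma>))"

text \<open>\<open>is_pullback C p q f g\<close>: the square \<open>f \<cdot> p = g \<cdot> q\<close> is cartesian; in particular
  \<open>p\<close> is a pullback of \<open>g\<close> along \<open>f\<close>.\<close>

definition is_pullback ::
  "('o, 'a, 'r) category_scheme \<Rightarrow> 'a \<Rightarrow> 'a \<Rightarrow> 'a \<Rightarrow> 'a \<Rightarrow> bool" where
  "is_pullback C p q f g \<longleftrightarrow>
    f \<in> Arr C \<and> g \<in> Arr C \<and> tgt C f = tgt C g \<and>
    p \<in> Hom C (src C p) (src C f) \<and> q \<in> Hom C (src C p) (src C g) \<and>
    f \<cdot>\<^bsub>C\<^esub> p = g \<cdot>\<^bsub>C\<^esub> q \<and>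
    (\<forall>W. \<forall>a\<in>Hom C W (src C f). \<forall>b\<in>Hom C W (src C g).
      f \<cdot>\<^bsub>C\<^esub> a = g \<cdot>\<^bsub>C\<^esub> b \<longrightarrow>
      (\<exists>!h. h \<in> Hom C W (src C p) \<and> p \<cdot>\<^bsub>C\<^esub> h = a \<and> q \<cdot>\<^bsub>C\<^esub> h = b))"

definition is_equalizer ::
  "('o, 'a, 'r) category_scheme \<Rightarrow> 'a \<Rightarrow> 'a \<Rightarrow> 'a \<Rightarrow> bool" where
  "is_equalizer C e f g \<longleftrightarrow>
    f \<in> Arr C \<and> g \<in> Hom C (src C f) (tgt C f) \<and>
    e \<in> Hom C (src C e) (src C f) \<and> f \<cdot>\<^bsub>C\<^esub> e = g \<cdot>\<^bsub>C\<^esub> e \<and>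
    (\<forall>W. \<forall>a\<in>Hom C W (src C f). f \<cdot>\<^bsub>C\<^esub> a = g \<cdot>\<^bsub>C\<^esub> a \<longrightarrow>
      (\<exists>!h. h \<in> Hom C W (src C e) \<and> e \<cdot>\<^bsub>C\<^esub> h = a))"

definition equalizer :: "('o, 'a, 'r) category_scheme \<Rightarrow> 'a \<Rightarrow> 'a \<Rightarrow> 'a" where
  "equalizer C f g = (SOME e. is_equalizer C e f g)"


section \<open>Categories with finite products\<close>

record ('o, 'a) fp_category = "('o, 'a) category" +
  One :: 'o
  Prd :: "'o \<Rightarrow> 'o \<Rightarrow> 'o"
  Pr1 :: "'o \<Rightarrow> 'o \<Rightarrow> 'a"
  Pr2 :: "'o \<Rightarrow> 'o \<Rightarrow> 'a"

locale fp_category = category C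
  for C :: "('o, 'a, 'r) fp_category_scheme" (structure) +
  assumes One_Obj: "One C \<in> Obj C"
    and One_terminal: "A \<in> Obj C \<Longrightarrow> \<exists>!f. f \<in> Hom C A (One C)"
    and Prd_Obj: "A \<in> Obj C \<Longrightarrow> B \<in> Obj C \<Longrightarrow> Prd C A B \<in> Obj C"
    and Pr1_Hom: "A \<in> Obj C \<Longrightarrow> B \<in> Obj C \<Longrightarrow> Pr1 C A B \<in> Hom C (Prd C A B) A"
    and Pr2_Hom: "A \<in> Obj C \<Longrightarrow> B \<in> Obj C \<Longrightarrow> Pr2 C A B \<in> Hom C (Prd C A B) B"
    and Prd_universal: "A \<in> Obj C \<Longrightarrow> B \<in> Obj C \<Longrightarrow> f \<in> Hom C W A \<Longrightarrow> g \<in> Hom C W B \<Longrightarrow>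
      \<exists>!h. h \<in> Hom C W (Prd C A B) \<and> Pr1 C A B \<cdot> h = f \<and> Pr2 C A B \<cdot> h = g"

definition bang :: "('o, 'a, 'r) fp_category_scheme \<Rightarrow> 'o \<Rightarrow> 'a" where
  "bang C A = (THE f. f \<in> Hom C A (One C))"

definition pair :: "('o, 'a, 'r) fp_category_scheme \<Rightarrow> 'a \<Rightarrow> 'a \<Rightarrow> 'a" where
  "pair C f g = (THE h. h \<in> Hom C (src C f) (Prd C (tgt C f) (tgt C g)) \<and>
    Pr1 C (tgt C f) (tgt C g) \<cdot>\<^bsub>C\<^esub> h = f \<and> Pr2 C (tgt C f) (tgt C g) \<cdot>\<^bsub>C\<^esub> h = g)"

text \<open>\<open>times_id C h A\<close> is the arrow \<open>h \<times> id\<^sub>A\<close>.\<close>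

definition times_id :: "('o, 'a, 'r) fp_category_scheme \<Rightarrow> 'a \<Rightarrow> 'o \<Rightarrow> 'a" where
  "times_id C h A = pair C (h \<cdot>\<^bsub>C\<^esub> Pr1 C (src C h) A) (Pr2 C (src C h) A)"


section \<open>Elementary toposes\<close>

text \<open>\<open>Exp E A B\<close> is the exponential \<open>B\<^sup>A\<close>, with evaluation \<open>Ev E A B : B\<^sup>A \<times> A \<rightarrow> B\<close>.\<close>

record ('o, 'a) topos = "('o, 'a) fp_category" +
  Exp :: "'o \<Rightarrow> 'o \<Rightarrow> 'o"
  Ev :: "'o \<Rightarrow> 'o \<Rightarrow> 'a"
  Omega :: 'o
  true :: 'a

locale topos = fp_category E
  for E :: "('o, 'a, 'r) topos_scheme" (structure) +
  assumes finite_limits: "has_finite_limits E"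
    and Exp_Obj: "A \<in> Obj E \<Longrightarrow> B \<in> Obj E \<Longrightarrow> Exp E A B \<in> Obj E"
    and Ev_Hom: "A \<in> Obj E \<Longrightarrow> B \<in> Obj E \<Longrightarrow> Ev E A B \<in> Hom E (Prd E (Exp E A B) A) B"
    and Exp_universal: "A \<in> Obj E \<Longrightarrow> B \<in> Obj E \<Longrightarrow> W \<in> Obj E \<Longrightarrow>
      f \<in> Hom E (Prd E W A) B \<Longrightarrow>
      \<exists>!h. h \<in> Hom E W (Exp E A B) \<and> Ev E A B \<cdot> times_id E h A = f"
    and Omega_Obj: "Omega E \<in> Obj E"
    and true_Hom: "true E \<in> Hom E (One E) (Omega E)"
    and Omega_classifies: "monic E m \<Longrightarrow>
      \<exists>!\<chi>. \<chi> \<in> Hom E (tgt E m) (Omega E) \<and> is_pullback E m (bang E (src E m)) \<chi> (true E)"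

definition curry_arr :: "('o, 'a, 'r) topos_scheme \<Rightarrow> 'o \<Rightarrow> 'o \<Rightarrow> 'o \<Rightarrow> 'a \<Rightarrow> 'a" where
  "curry_arr E W A B f =
    (THE h. h \<in> Hom E W (Exp E A B) \<and> Ev E A B \<cdot>\<^bsub>E\<^esub> times_id E h A = f)"

definition char_map :: "('o, 'a, 'r) topos_scheme \<Rightarrow> 'a \<Rightarrow> 'a" where
  "char_map E m = (THE \<chi>. \<chi> \<in> Hom E (tgt E m) (Omega E) \<and>
    is_pullback E m (bang E (src E m)) \<chi> (true E))"

definition true_at :: "('o, 'a, 'r) topos_scheme \<Rightarrow> 'o \<Rightarrow> 'a" where
  "true_at E A = true E \<cdot>\<^bsub>E\<^esub> bang E A"


section \<open>Models of guarded recursive terms\<close>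

locale guarded_model = fp_category C + L: cat_functor C C Lo La
  for C :: "('o, 'a, 'r) fp_category_scheme" (structure)
    and Lo :: "'o \<Rightarrow> 'o" and La :: "'a \<Rightarrow> 'a" and nxt :: "'o \<Rightarrow> 'a" +
  assumes later_limits: "preserves_finite_limits C C Lo La"
    and nxt_Hom: "A \<in> Obj C \<Longrightarrow> nxt A \<in> Hom C A (Lo A)"
    and nxt_natural: "f \<in> Hom C A B \<Longrightarrow> La f \<cdot> nxt A = nxt B \<cdot> f"
    and guarded_fixpoint: "X \<in> Obj C \<Longrightarrow> f \<in> Hom C (Lo X) X \<Longrightarrow>
      \<exists>!h. h \<in> Hom C (One C) X \<and> f \<cdot> (nxt X \<cdot> h) = h"

text \<open>A representative of the subobject \<open>\<rhd>m\<close>, determined up to isomorphism over \<open>tgt m\<close>.\<close>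

definition later_sub ::
  "('o, 'a, 'r) category_scheme \<Rightarrow> ('a \<Rightarrow> 'a) \<Rightarrow> ('o \<Rightarrow> 'a) \<Rightarrow> 'a \<Rightarrow> 'a" where
  "later_sub C La nxt m = (SOME n. \<exists>k. is_pullback C n k (nxt (tgt C m)) (La m))"

text \<open>The operation \<open>\<rhd>\<close> on subobjects is a natural transformation
  \<open>Hom(-, \<Omega>) \<cong> Sub \<rightarrow> Sub \<cong> Hom(-, \<Omega>)\<close>. The arrow \<open>\<Omega> \<rightarrow> \<Omega>\<close> that the Yoneda lemma assigns
  to it is its value at the identity of \<open>\<Omega>\<close>, which classifies the subobject \<open>true\<close>.\<close>

definition later_Omega ::
  "('o, 'a, 'r) topos_scheme \<Rightarrow> ('a \<Rightarrow> 'a) \<Rightarrow> ('o \<Rightarrow> 'a) \<Rightarrow> 'a" where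
  "later_Omega E La nxt = char_map E (later_sub E La nxt (true E))"


section \<open>The internal logic\<close>

definition and_Omega :: "('o, 'a, 'r) topos_scheme \<Rightarrow> 'a" where
  "and_Omega E = char_map E (pair E (true E) (true E))"

text \<open>Implication classifies the internal order of \<open>\<Omega>\<close>, the equalizer of \<open>\<and>\<close> and the
  first projection.\<close>

definition imp_Omega :: "('o, 'a, 'r) topos_scheme \<Rightarrow> 'a" where
  "imp_Omega E = char_map E (equalizer E (and_Omega E) (Pr1 E (Omega E) (Omega E)))"

text \<open>\<open>\<forall>\<^sub>A : \<Omega>\<^sup>A \<rightarrow> \<Omega>\<close> classifies the name \<open>1 \<rightarrow> \<Omega>\<^sup>A\<close> of the maximal subobject of \<open>A\<close>.\<close>

definition all_Omega :: "('o, 'a, 'r) topos_scheme \<Rightarrow> 'o \<Rightarrow> 'a" where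
  "all_Omega E A =
    char_map E (curry_arr E (One E) A (Omega E) (true_at E (Prd E (One E) A)))"

text \<open>A fragment of the Mitchell-Benabou language in de Bruijn notation; \<open>App f t\<close> applies an
  arrow \<open>f\<close> of the topos, formulas are the terms of type \<open>\<Omega>\<close>, and \<open>All A \<phi>\<close> binds a
  variable of type \<open>A\<close>. Only well-typed terms have a meaningful interpretation.\<close>

datatype ('o, 'a) tm =
    Var nat
  | App 'a "('o, 'a) tm"
  | Top
  | Conj "('o, 'a) tm" "('o, 'a) tm"
  | Imp "('o, 'a) tm" "('o, 'a) tm"
  | All 'o "('o, 'a) tm"

text \<open>A context lists the types of the variables, the most recently bound one first.\<close>

fun ctx_obj :: "('o, 'a, 'r) topos_scheme \<Rightarrow> 'o list \<Rightarrow> 'o" where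
  "ctx_obj E [] = One E"
| "ctx_obj E (A # \<Gamma>) = Prd E (ctx_obj E \<Gamma>) A"

fun var_arr :: "('o, 'a, 'r) topos_scheme \<Rightarrow> 'o list \<Rightarrow> nat \<Rightarrow> 'a" where
  "var_arr E [] n = undefined"
| "var_arr E (A # \<Gamma>) 0 = Pr2 E (ctx_obj E \<Gamma>) A"
| "var_arr E (A # \<Gamma>) (Suc n) = var_arr E \<Gamma> n \<cdot>\<^bsub>E\<^esub> Pr1 E (ctx_obj E \<Gamma>) A"

primrec interp :: "('o, 'a, 'r) topos_scheme \<Rightarrow> 'o list \<Rightarrow> ('o, 'a) tm \<Rightarrow> 'a" where
  "interp E \<Gamma> (Var n) = var_arr E \<Gamma> n"
| "interp E \<Gamma> (App f t) = f \<cdot>\<^bsub>E\<^esub> interp E \<Gamma> t"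
| "interp E \<Gamma> Top = true_at E (ctx_obj E \<Gamma>)"
| "interp E \<Gamma> (Conj \<phi> \<psi>) = and_Omega E \<cdot>\<^bsub>E\<^esub> pair E (interp E \<Gamma> \<phi>) (interp E \<Gamma> \<psi>)"
| "interp E \<Gamma> (Imp \<phi> \<psi>) = imp_Omega E \<cdot>\<^bsub>E\<^esub> pair E (interp E \<Gamma> \<phi>) (interp E \<Gamma> \<psi>)"
| "interp E \<Gamma> (All A \<phi>) =
    all_Omega E A \<cdot>\<^bsub>E\<^esub> curry_arr E (ctx_obj E \<Gamma>) A (Omega E) (interp E (A # \<Gamma>) \<phi>)"

definition valid :: "('o, 'a, 'r) topos_scheme \<Rightarrow> 'o list \<Rightarrow> ('o, 'a) tm \<Rightarrow> bool" where
  "valid E \<Gamma> \<phi> \<longleftrightarrow> interp E \<Gamma> \<phi> = true_at E (ctx_obj E \<Gamma>)"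

end

(* Externally, the principle says that a predicate phi on an object M with "later phi" <= phi is
   true. Let U be the subobject of 1 on which phi holds throughout M, that is, the interpretation
   of "forall x:M. phi x". Since "later" preserves products, phi holds later on (later U) x M, hence
   already now, so there is an arrow later U -> U. Its fixed point is a global element of U, so
   that U = 1. The internal statement follows by taking M to be the extent of "later p -> p". *)

theory Submission
  imports Defs
begin

section \<open>Limits\<close>

context category
begin

lemma HomD:
  assumes "f \<in> Hom C A B"
  shows "f \<in> Arr C" "src C f = A" "tgt C f = B" "A \<in> Obj C" "B \<in> Obj C"
  using assms src_Obj tgt_Obj by (auto simp: Hom_def)

lemma Arr_Hom: "f \<in> Arr C \<Longrightarrow> f \<in> Hom C (src C f) (tgt C f)"
  by (simp add: Hom_def)

lemma monicD:
  "monic C m \<Longrightarrow> u \<in> Hom C W (src C m) \<Longrightarrow> v \<in> Hom C W (src C m) \<Longrightarrow> m \<cdot> u = m \<cdot> v \<Longrightarrow> u = v"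
  by (simp add: monic_def)

lemma pullback_universal:
  "is_pullback C p q f g \<Longrightarrow> a \<in> Hom C W (src C f) \<Longrightarrow> b \<in> Hom C W (src C g) \<Longrightarrow>
    f \<cdot> a = g \<cdot> b \<Longrightarrow> \<exists>!h. h \<in> Hom C W (src C p) \<and> p \<cdot> h = a \<and> q \<cdot> h = b"
  by (simp add: is_pullback_def)

text \<open>Limits are available only for diagrams shaped by finite categories of natural numbers,
  so the parallel pair has to be coded as such a shape. Apart from the chosen products, this is the
  only finite limit taken directly from the completeness assumption.\<close>

lemma equalizer_exists:
  assumes lim: "has_finite_limits C" and f: "f \<in> Hom C A B" and g: "g \<in> Hom C A B"
  shows "\<exists>e. is_equalizer C e f g"
proof -
  \<comment> \<open>Arrows 0 and 1 are the identities of the objects 0 and 1, and arrows 2 and 3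
    form the parallel pair from 0 to 1. In a composable pair, \<open>u < 2\<close> means that
    \<open>u\<close> is an identity; otherwise \<open>v\<close> is the identity of 1.\<close>
  define J :: "(nat, nat) category" where
    "J = \<lparr>Obj = {0, 1}, Arr = {0, 1, 2, 3}, src = (\<lambda>n. if n = 1 then 1 else 0),
      tgt = (\<lambda>n. if n = 0 then 0 else 1), idt = (\<lambda>n. n), cmp = (\<lambda>v u. if u < 2 then v else u)\<rparr>"
  define Do where "Do i = (if i = 0 then A else B)" for i :: nat
  define Da where
    "Da u = (if u = 0 then idt C A else if u = 1 then idt C B else if u = 2 then f else g)"
    for u :: nat
  note AB = HomD(4,5)[OF f]
  note ids = idt_Hom[OF AB(1)] idt_Hom[OF AB(2)]
  have J_Hom: "u \<in> Hom J i j \<longleftrightarrow> u = 0 \<and> i = 0 \<and> j = 0 \<or> u = 1 \<and> i = 1 \<and> j = 1 \<or>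
      u = 2 \<and> i = 0 \<and> j = 1 \<or> u = 3 \<and> i = 0 \<and> j = 1" for u i j
    by (auto simp: J_def Hom_def)
  have J_Obj: "i \<in> Obj J \<longleftrightarrow> i = 0 \<or> i = 1" for i
    by (simp add: J_def)
  have J_idt: "idt J i = i" for i
    by (simp add: J_def)
  have J_cmp: "v \<cdot>\<^bsub>J\<^esub> u = (if u < 2 then v else u)" for u v
    by (simp add: J_def)
  have "category J"
  proof
    show "u \<in> Arr J \<Longrightarrow> src J u \<in> Obj J" "u \<in> Arr J \<Longrightarrow> tgt J u \<in> Obj J" for u
      by (simp_all add: J_def)
  qed (unfold J_Hom J_Obj J_idt J_cmp, (elim disjE conjE; simp)+)
  moreover have "cat_functor_axioms J C Do Da"
  proof
    have "Da 0 \<in> Hom C A A" "Da 1 \<in> Hom C B B" "Da 2 \<in> Hom C A B" "Da 3 \<in> Hom C A B"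
      using ids f g by (simp_all add: Da_def)
    then show "u \<in> Hom J i j \<Longrightarrow> Da u \<in> Hom C (Do i) (Do j)" for u i j
      unfolding J_Hom by (elim disjE conjE; simp add: Do_def)
    show "u \<in> Hom J i j \<Longrightarrow> v \<in> Hom J j k \<Longrightarrow> Da (v \<cdot>\<^bsub>J\<^esub> u) = Da v \<cdot> Da u" for u v i j k
      using cmp_idt[OF f] cmp_idt[OF g] idt_cmp[OF f] idt_cmp[OF g]
        cmp_idt[OF ids(1)] cmp_idt[OF ids(2)]
      unfolding J_Hom J_cmp by (elim disjE conjE; simp add: Da_def)
  qed (auto simp: J_Obj J_idt Do_def Da_def AB)
  ultimately have "finite_diagram J C Do Da"
    using category_axioms by (simp add: finite_diagram_def cat_functor_def J_def)
  then obtain V \<sigma> where V: "limit_cone J C Do Da V \<sigma>"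
    using lim unfolding has_finite_limits_def by blast
  \<comment> \<open>The leg at 1 is forced by the leg at 0, so a cone amounts to one arrow into
    \<open>A\<close> that equalizes \<open>f\<close> and \<open>g\<close>.\<close>
  have cone: "cone J C Do Da W \<tau> \<longleftrightarrow> W \<in> Obj C \<and> \<tau> 0 \<in> Hom C W A \<and> \<tau> 1 \<in> Hom C W B \<and>
      f \<cdot> \<tau> 0 = \<tau> 1 \<and> g \<cdot> \<tau> 0 = \<tau> 1" for W \<tau>
    using idt_cmp by (auto simp: cone_def J_def Do_def Da_def)
  have \<sigma>: "\<sigma> 0 \<in> Hom C V A" "\<sigma> 1 \<in> Hom C V B" "f \<cdot> \<sigma> 0 = \<sigma> 1" "g \<cdot> \<sigma> 0 = \<sigma> 1"
    using V by (auto simp: limit_cone_def cone)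
  have "\<exists>!h. h \<in> Hom C W V \<and> \<sigma> 0 \<cdot> h = a" if a: "a \<in> Hom C W A" and eq: "f \<cdot> a = g \<cdot> a" for W a
  proof -
    have "cone J C Do Da W (\<lambda>i. if i = 0 then a else f \<cdot> a)"
      using a eq cmp_Hom[OF a f] HomD(4)[OF a] by (simp add: cone)
    then have "\<exists>!h. h \<in> Hom C W V \<and> (\<forall>i\<in>Obj J. \<sigma> i \<cdot> h = (if i = 0 then a else f \<cdot> a))"
      using V unfolding limit_cone_def by blast
    then have "\<exists>!h. h \<in> Hom C W V \<and> \<sigma> 0 \<cdot> h = a \<and> \<sigma> 1 \<cdot> h = f \<cdot> a"
      by (simp add: J_def)
    moreover have "\<sigma> 1 \<cdot> h = f \<cdot> a" if "h \<in> Hom C W V" "\<sigma> 0 \<cdot> h = a" for h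
      using cmp_assoc[OF that(1) \<sigma>(1) f] \<sigma>(3) that(2) by simp
    ultimately show ?thesis
      by blast
  qed
  then have "is_equalizer C (\<sigma> 0) f g"
    using HomD[OF f] g HomD[OF \<sigma>(1)] \<sigma> unfolding is_equalizer_def by simp
  then show ?thesis ..
qed

lemma equalizer_monic:
  assumes "is_equalizer C e f g"
  shows "monic C e"
  unfolding monic_def
proof (intro conjI allI ballI impI)
  have e: "e \<in> Hom C (src C e) (src C f)" "f \<cdot> e = g \<cdot> e"
    and f: "f \<in> Hom C (src C f) (tgt C f)" and g: "g \<in> Hom C (src C f) (tgt C f)"
    using assms Arr_Hom by (auto simp: is_equalizer_def)
  show "e \<in> Arr C"
    using e HomD by blast
  fix W u v
  assume u: "u \<in> Hom C W (src C e)" and v: "v \<in> Hom C W (src C e)" and eq: "e \<cdot> u = e \<cdot> v"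
  have "f \<cdot> (e \<cdot> u) = g \<cdot> (e \<cdot> u)"
    using cmp_assoc[OF u e(1) f] cmp_assoc[OF u e(1) g] e(2) by simp
  then have "\<exists>!h. h \<in> Hom C W (src C e) \<and> e \<cdot> h = e \<cdot> u"
    using assms cmp_Hom[OF u e(1)] unfolding is_equalizer_def by blast
  then show "u = v"
    using u v eq by metis
qed

lemma equalizer_factor_iff:
  assumes eq: "is_equalizer C e f g" and a: "a \<in> Hom C W (src C f)"
  shows "(\<exists>h. h \<in> Hom C W (src C e) \<and> e \<cdot> h = a) \<longleftrightarrow> f \<cdot> a = g \<cdot> a"
proof
  have e: "e \<in> Hom C (src C e) (src C f)" "f \<cdot> e = g \<cdot> e"
    and f: "f \<in> Hom C (src C f) (tgt C f)" and g: "g \<in> Hom C (src C f) (tgt C f)"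
    using eq Arr_Hom by (auto simp: is_equalizer_def)
  show "f \<cdot> a = g \<cdot> a" if "\<exists>h. h \<in> Hom C W (src C e) \<and> e \<cdot> h = a"
    using that cmp_assoc[OF _ e(1) f] cmp_assoc[OF _ e(1) g] e(2) by metis
  show "\<exists>h. h \<in> Hom C W (src C e) \<and> e \<cdot> h = a" if "f \<cdot> a = g \<cdot> a"
    using eq a that unfolding is_equalizer_def by blast
qed

text \<open>From \<open>f \<cdot> a = s \<cdot> b\<close> and the retraction \<open>r\<close> it
  follows that \<open>b = r \<cdot> f \<cdot> a\<close>. The second leg is therefore determined by
  the first, and an equalizer of \<open>f\<close> and \<open>s \<cdot> r \<cdot> f\<close> already
  is the pullback.\<close>

lemma pullback_of_split_monic:
  assumes lim: "has_finite_limits C" and f: "f \<in> Hom C A B" and s: "s \<in> Hom C D B"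
    and r: "r \<in> Hom C B D" and rs: "r \<cdot> s = idt C D"
  shows "\<exists>p q. is_pullback C p q f s"
proof -
  note rf = cmp_Hom[OF f r]
  note srf = cmp_Hom[OF rf s]
  obtain e where e: "is_equalizer C e f (s \<cdot> (r \<cdot> f))"
    using equalizer_exists[OF lim f srf] by blast
  have eH: "e \<in> Hom C (src C e) A" and eeq: "f \<cdot> e = (s \<cdot> (r \<cdot> f)) \<cdot> e"
    using e HomD[OF f] by (auto simp: is_equalizer_def)
  have mono: "u = v" if "u \<in> Hom C W (src C e)" "v \<in> Hom C W (src C e)" "e \<cdot> u = e \<cdot> v" for W u v
    using monicD[OF equalizer_monic[OF e] that] .
  have "\<exists>!h. h \<in> Hom C W (src C e) \<and> e \<cdot> h = a \<and> ((r \<cdot> f) \<cdot> e) \<cdot> h = b"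
    if a: "a \<in> Hom C W A" and b: "b \<in> Hom C W D" and ab: "f \<cdot> a = s \<cdot> b" for W a b
  proof -
    have rfa: "(r \<cdot> f) \<cdot> a = b"
      using cmp_assoc[OF a f r] ab cmp_assoc[OF b s r] rs idt_cmp[OF b] by simp
    then have "f \<cdot> a = (s \<cdot> (r \<cdot> f)) \<cdot> a"
      using cmp_assoc[OF a rf s] ab by simp
    then obtain h where h: "h \<in> Hom C W (src C e)" "e \<cdot> h = a"
      using equalizer_factor_iff[OF e, of a W] a HomD[OF f] by auto
    then have "((r \<cdot> f) \<cdot> e) \<cdot> h = b"
      using cmp_assoc[OF h(1) eH rf] rfa by simp
    then show ?thesis
      using h mono by blast
  qed
  then have "is_pullback C e ((r \<cdot> f) \<cdot> e) f s"
    using HomD[OF f] HomD[OF s] eH cmp_Hom[OF eH rf] eeq cmp_assoc[OF eH rf s]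
    by (simp add: is_pullback_def)
  then show ?thesis
    by blast
qed

lemma split_monic:
  assumes s: "s \<in> Hom C D B" and r: "r \<in> Hom C B D" and rs: "r \<cdot> s = idt C D"
  shows "monic C s"
  unfolding monic_def
proof (intro conjI allI ballI impI)
  show "s \<in> Arr C"
    using HomD[OF s] by simp
  fix W u v
  assume "u \<in> Hom C W (src C s)" "v \<in> Hom C W (src C s)" and eq: "s \<cdot> u = s \<cdot> v"
  then have u: "u \<in> Hom C W D" and v: "v \<in> Hom C W D"
    using HomD[OF s] by auto
  show "u = v"
    using cmp_assoc[OF u s r] cmp_assoc[OF v s r] eq rs idt_cmp[OF u] idt_cmp[OF v] by simp
qed

text \<open>Membership of a generalized element \<open>a\<close> in the pulled back subobject,
  tested by membership of \<open>f \<cdot> a\<close> in the original one.\<close>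

lemma pullback_factor_iff:
  assumes pb: "is_pullback C p q f g" and a: "a \<in> Hom C W (src C f)"
  shows "(\<exists>h. h \<in> Hom C W (src C p) \<and> p \<cdot> h = a) \<longleftrightarrow> (\<exists>b. b \<in> Hom C W (src C g) \<and> f \<cdot> a = g \<cdot> b)"
proof
  have p: "p \<in> Hom C (src C p) (src C f)" and q: "q \<in> Hom C (src C p) (src C g)"
    and eq: "f \<cdot> p = g \<cdot> q"
    and f: "f \<in> Hom C (src C f) (tgt C f)" and g: "g \<in> Hom C (src C g) (tgt C f)"
    using pb Arr_Hom by (auto simp: is_pullback_def Hom_def)
  show "\<exists>b. b \<in> Hom C W (src C g) \<and> f \<cdot> a = g \<cdot> b"
    if "\<exists>h. h \<in> Hom C W (src C p) \<and> p \<cdot> h = a"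
    using that cmp_assoc[OF _ p f] cmp_assoc[OF _ q g] cmp_Hom[OF _ q] eq by metis
  show "\<exists>h. h \<in> Hom C W (src C p) \<and> p \<cdot> h = a"
    if "\<exists>b. b \<in> Hom C W (src C g) \<and> f \<cdot> a = g \<cdot> b"
    using that pullback_universal[OF pb a] by blast
qed

lemma pullback_monic:
  assumes pb: "is_pullback C p q f g" and g: "monic C g"
  shows "monic C p"
  unfolding monic_def
proof (intro conjI allI ballI impI)
  have p: "p \<in> Hom C (src C p) (src C f)" and q: "q \<in> Hom C (src C p) (src C g)"
    and eq: "f \<cdot> p = g \<cdot> q"
    and fH: "f \<in> Hom C (src C f) (tgt C f)" and gH: "g \<in> Hom C (src C g) (tgt C f)"
    using pb Arr_Hom by (auto simp: is_pullback_def Hom_def)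
  show "p \<in> Arr C"
    using HomD[OF p] by simp
  fix W u v
  assume u: "u \<in> Hom C W (src C p)" and v: "v \<in> Hom C W (src C p)" and uv: "p \<cdot> u = p \<cdot> v"
  have fg: "f \<cdot> (p \<cdot> w) = g \<cdot> (q \<cdot> w)" if "w \<in> Hom C W (src C p)" for w
    using cmp_assoc[OF that p fH] cmp_assoc[OF that q gH] eq by simp
  have "g \<cdot> (q \<cdot> u) = g \<cdot> (q \<cdot> v)"
    using fg[OF u] fg[OF v] unfolding uv by (rule trans[OF sym])
  then have qv: "q \<cdot> u = q \<cdot> v"
    by (rule monicD[OF g cmp_Hom[OF u q] cmp_Hom[OF v q]])
  \<comment> \<open>Both \<open>u\<close> and \<open>v\<close> mediate for the same cone, with legs
    \<open>p \<cdot> v\<close> and \<open>q \<cdot> v\<close>.\<close>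
  note ex1 = pullback_universal[OF pb cmp_Hom[OF v p] cmp_Hom[OF v q] fg[OF v]]
  show "u = v"
    by (rule trans[OF sym[OF the1_equality[OF ex1, of u]] the1_equality[OF ex1, of v]])
      (simp_all add: u v uv qv)
qed

end


section \<open>Finite products\<close>

context fp_category
begin

lemma bang_Hom: "A \<in> Obj C \<Longrightarrow> bang C A \<in> Hom C A (One C)"
  unfolding bang_def by (rule theI') (rule One_terminal)

lemma One_eq: "f \<in> Hom C A (One C) \<Longrightarrow> g \<in> Hom C A (One C) \<Longrightarrow> f = g"
  using One_terminal HomD(4) by blast

lemma bang_cmp: "f \<in> Hom C A B \<Longrightarrow> bang C B \<cdot> f = bang C A"
  by (rule One_eq[OF cmp_Hom bang_Hom]) (auto dest: HomD intro: bang_Hom)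

lemma monic_from_One:
  assumes "f \<in> Hom C (One C) A"
  shows "monic C f"
  using assms One_eq HomD[OF assms] by (auto simp: monic_def)

section \<open>Pairing, and the product of an arrow with an identity\<close>

lemma pair_props:
  assumes f: "f \<in> Hom C W A" and g: "g \<in> Hom C W B"
  shows "pair C f g \<in> Hom C W (Prd C A B)" "Pr1 C A B \<cdot> pair C f g = f" "Pr2 C A B \<cdot> pair C f g = g"
proof -
  from theI'[OF Prd_universal[OF HomD(5)[OF f] HomD(5)[OF g] f g]]
  show "pair C f g \<in> Hom C W (Prd C A B)" "Pr1 C A B \<cdot> pair C f g = f"
    "Pr2 C A B \<cdot> pair C f g = g"
    using HomD[OF f] HomD[OF g] by (auto simp: pair_def)
qed

lemma pair_unique:
  assumes "f \<in> Hom C W A" "g \<in> Hom C W B"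
    and "h \<in> Hom C W (Prd C A B)" "Pr1 C A B \<cdot> h = f" "Pr2 C A B \<cdot> h = g"
  shows "pair C f g = h"
  using the1_equality[OF
      Prd_universal[OF HomD(5)[OF assms(1)] HomD(5)[OF assms(2)] assms(1,2)], of h] assms
  by (simp add: pair_def HomD[OF assms(1)] HomD[OF assms(2)])

lemma pair_cmp:
  assumes f: "f \<in> Hom C W A" and g: "g \<in> Hom C W B" and w: "w \<in> Hom C V W"
  shows "pair C f g \<cdot> w = pair C (f \<cdot> w) (g \<cdot> w)"
proof (rule sym, rule pair_unique)
  note AB = HomD(5)[OF f] HomD(5)[OF g]
  note p = pair_props[OF f g]
  show "f \<cdot> w \<in> Hom C V A" "g \<cdot> w \<in> Hom C V B" "pair C f g \<cdot> w \<in> Hom C V (Prd C A B)"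
    using cmp_Hom w f g p by blast+
  show "Pr1 C A B \<cdot> (pair C f g \<cdot> w) = f \<cdot> w" "Pr2 C A B \<cdot> (pair C f g \<cdot> w) = g \<cdot> w"
    using cmp_assoc[OF w p(1) Pr1_Hom[OF AB]] cmp_assoc[OF w p(1) Pr2_Hom[OF AB]] p by auto
qed

lemma times_id_props:
  assumes h: "h \<in> Hom C W V" and A: "A \<in> Obj C"
  shows "times_id C h A \<in> Hom C (Prd C W A) (Prd C V A)"
    and "Pr1 C V A \<cdot> times_id C h A = h \<cdot> Pr1 C W A"
    and "Pr2 C V A \<cdot> times_id C h A = Pr2 C W A"
proof -
  have W: "W \<in> Obj C" "src C h = W"
    using HomD[OF h] by auto
  show "times_id C h A \<in> Hom C (Prd C W A) (Prd C V A)"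
    "Pr1 C V A \<cdot> times_id C h A = h \<cdot> Pr1 C W A" "Pr2 C V A \<cdot> times_id C h A = Pr2 C W A"
    using pair_props[OF cmp_Hom[OF Pr1_Hom[OF W(1) A] h] Pr2_Hom[OF W(1) A]]
    by (simp_all add: times_id_def W)
qed

lemma times_id_cmp:
  assumes h: "h \<in> Hom C W V" and k: "k \<in> Hom C V U" and A: "A \<in> Obj C"
  shows "times_id C (k \<cdot> h) A = times_id C k A \<cdot> times_id C h A"
proof -
  note W = HomD(4)[OF h] and V = HomD(5)[OF h] and U = HomD(5)[OF k]
  note th = times_id_props[OF h A] and tk = times_id_props[OF k A]
  note p1 = Pr1_Hom[OF W A] and kh = cmp_Hom[OF h k]
  have "Pr1 C U A \<cdot> (times_id C k A \<cdot> times_id C h A) = (k \<cdot> h) \<cdot> Pr1 C W A"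
    using cmp_assoc[OF th(1) tk(1) Pr1_Hom[OF U A]] tk(2)
      cmp_assoc[OF th(1) Pr1_Hom[OF V A] k] th(2) cmp_assoc[OF p1 h k] by simp
  moreover have "Pr2 C U A \<cdot> (times_id C k A \<cdot> times_id C h A) = Pr2 C W A"
    using cmp_assoc[OF th(1) tk(1) Pr2_Hom[OF U A]] tk(3) th(3) by simp
  ultimately show ?thesis
    unfolding times_id_def[of C "k \<cdot> h"]
    using pair_unique[OF cmp_Hom[OF p1 kh] Pr2_Hom[OF W A] cmp_Hom[OF th(1) tk(1)]] HomD[OF kh]
    by simp
qed

text \<open>A binary product is a limit over the discrete category with two objects, so its image
  under the functor is again a limit. This supplies arrows into
  \<open>Fo (Prd C A B)\<close>.\<close>

lemma functor_preserves_pairing: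
  assumes F: "cat_functor C D Fo Fa" and pres: "preserves_finite_limits C D Fo Fa"
    and A: "A \<in> Obj C" and B: "B \<in> Obj C"
    and a: "a \<in> Hom D W (Fo A)" and b: "b \<in> Hom D W (Fo B)"
  shows "\<exists>c. c \<in> Hom D W (Fo (Prd C A B)) \<and>
    Fa (Pr1 C A B) \<cdot>\<^bsub>D\<^esub> c = a \<and> Fa (Pr2 C A B) \<cdot>\<^bsub>D\<^esub> c = b"
proof -
  interpret F: cat_functor C D Fo Fa by (rule F)
  \<comment> \<open>The discrete shape: each of 0 and 1 is both an object and its own identity, and
    only equal arrows are composable.\<close>
  define J :: "(nat, nat) category" where
    "J = \<lparr>Obj = {0, 1}, Arr = {0, 1}, src = (\<lambda>n. n), tgt = (\<lambda>n. n), idt = (\<lambda>n. n),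
      cmp = (\<lambda>v u. u)\<rparr>"
  define Do where "Do i = (if i = 0 then A else B)" for i :: nat
  define Da where "Da u = (if u = 0 then idt C A else idt C B)" for u :: nat
  define \<sigma> where "\<sigma> i = (if i = 0 then Pr1 C A B else Pr2 C A B)" for i :: nat
  define \<tau> where "\<tau> i = (if i = 0 then a else b)" for i :: nat
  have "category J"
    by unfold_locales (auto simp: J_def Hom_def split: if_splits)
  moreover have "cat_functor_axioms J C Do Da"
    using A B idt_Hom[OF A] idt_Hom[OF B] cmp_idt[OF idt_Hom[OF A]] cmp_idt[OF idt_Hom[OF B]]
    by unfold_locales (auto simp: J_def Do_def Da_def Hom_def split: if_splits)
  ultimately have diag: "finite_diagram J C Do Da"
    using category_axioms by (simp add: finite_diagram_def cat_functor_def J_def)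
  have "limit_cone J C Do Da (Prd C A B) \<sigma>"
    unfolding limit_cone_def
  proof (intro conjI allI impI)
    show "cone J C Do Da (Prd C A B) \<sigma>"
      using Prd_Obj[OF A B] Pr1_Hom[OF A B] Pr2_Hom[OF A B] idt_cmp
      by (auto simp: cone_def J_def Do_def Da_def \<sigma>_def)
    fix W \<tau>
    assume "cone J C Do Da W \<tau>"
    then have "\<tau> 0 \<in> Hom C W A" "\<tau> 1 \<in> Hom C W B"
      by (auto simp: cone_def J_def Do_def)
    from Prd_universal[OF A B this]
    show "\<exists>!h. h \<in> Hom C W (Prd C A B) \<and> (\<forall>i\<in>Obj J. \<sigma> i \<cdot> h = \<tau> i)"
      by (simp add: J_def \<sigma>_def)
  qed
  then have lim: "limit_cone J D (Fo \<circ> Do) (Fa \<circ> Da) (Fo (Prd C A B)) (Fa \<circ> \<sigma>)"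
    using pres diag unfolding preserves_finite_limits_def by blast
  have "cone J D (Fo \<circ> Do) (Fa \<circ> Da) W \<tau>"
    using F.C.HomD(4)[OF a] a b F.Fa_idt[OF A] F.Fa_idt[OF B] F.C.idt_cmp
    by (auto simp: cone_def J_def Do_def Da_def \<tau>_def)
  then obtain c where "c \<in> Hom D W (Fo (Prd C A B))" "\<forall>i\<in>Obj J. (Fa \<circ> \<sigma>) i \<cdot>\<^bsub>D\<^esub> c = \<tau> i"
    using lim unfolding limit_cone_def by blast
  then show ?thesis
    by (auto simp: J_def \<sigma>_def \<tau>_def)
qed

end


section \<open>Truth values\<close>

context topos
begin

lemma true_at_Hom: "A \<in> Obj E \<Longrightarrow> true_at E A \<in> Hom E A (Omega E)"
  using bang_Hom true_Hom cmp_Hom unfolding true_at_def by blast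

lemma true_at_cmp:
  assumes "f \<in> Hom E A B"
  shows "true_at E B \<cdot> f = true_at E A"
  using cmp_assoc[OF assms bang_Hom true_Hom] bang_cmp[OF assms] HomD(5)[OF assms]
  by (simp add: true_at_def)

lemma true_cmp:
  assumes "f \<in> Hom E A (One E)"
  shows "true E \<cdot> f = true_at E A"
  using One_eq[OF assms bang_Hom] HomD(4)[OF assms] by (simp add: true_at_def)

lemma char_map_props:
  assumes "monic E m"
  shows "char_map E m \<in> Hom E (tgt E m) (Omega E)"
    and "is_pullback E m (bang E (src E m)) (char_map E m) (true E)"
  using theI'[OF Omega_classifies[OF assms]] by (auto simp: char_map_def)

text \<open>The bridge from arrows into \<open>\<Omega>\<close> to subobjects. Every connective
  below is a \<open>char_map\<close>, and its truth at a generalized element is computed through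
  this equivalence.\<close>

lemma char_map_true_iff:
  assumes m: "monic E m" and w: "w \<in> Hom E W (tgt E m)"
  shows "char_map E m \<cdot> w = true_at E W \<longleftrightarrow> (\<exists>h. h \<in> Hom E W (src E m) \<and> m \<cdot> h = w)"
proof -
  note ch = char_map_props[OF m]
  have "w \<in> Hom E W (src E (char_map E m))"
    using w HomD[OF ch(1)] by simp
  from pullback_factor_iff[OF ch(2) this] show ?thesis
    using true_cmp bang_Hom[OF HomD(4)[OF w]] HomD[OF true_Hom] by auto
qed

text \<open>This equalizer is the extent of the predicate \<open>r\<close>, the subobject of
  \<open>X\<close> on which \<open>r\<close> holds. It stands in for a pullback of
  \<open>true E\<close> along \<open>r\<close>.\<close>

lemma truth_equalizer_exists:
  assumes "r \<in> Hom E X (Omega E)"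
  obtains e where "is_equalizer E e r (true_at E X)"
  using equalizer_exists[OF finite_limits assms true_at_Hom] HomD(4)[OF assms] by blast

lemma truth_equalizer_factor_iff:
  assumes "r \<in> Hom E X (Omega E)" "is_equalizer E e r (true_at E X)" "a \<in> Hom E W X"
  shows "(\<exists>h. h \<in> Hom E W (src E e) \<and> e \<cdot> h = a) \<longleftrightarrow> r \<cdot> a = true_at E W"
  using equalizer_factor_iff[OF assms(2), of a W] assms HomD[OF assms(1)] true_at_cmp[OF assms(3)]
  by simp

text \<open>Arrows into the terminal object are unique, so the equalizer square is also a pullback
  of \<open>true E\<close> along \<open>r\<close>. Uniqueness of classifying maps then identifies
  \<open>r\<close>.\<close>

lemma truth_equalizer_char_map:
  assumes r: "r \<in> Hom E X (Omega E)" and e: "is_equalizer E e r (true_at E X)"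
  shows "char_map E e = r"
proof -
  note R = HomD[OF r] and m = equalizer_monic[OF e] and T = HomD[OF true_Hom]
  have eH: "e \<in> Hom E (src E e) X"
    using e R by (simp add: is_equalizer_def)
  have re: "r \<cdot> e = true E \<cdot> bang E (src E e)"
    using e true_at_cmp[OF eH] by (simp add: is_equalizer_def true_at_def)
  have "\<exists>!h. h \<in> Hom E W (src E e) \<and> e \<cdot> h = a \<and> bang E (src E e) \<cdot> h = b"
    if a: "a \<in> Hom E W X" and b: "b \<in> Hom E W (One E)" and ab: "r \<cdot> a = true E \<cdot> b" for W a b
  proof -
    have "\<exists>h. h \<in> Hom E W (src E e) \<and> e \<cdot> h = a"
      using truth_equalizer_factor_iff[OF r e a] ab true_cmp[OF b] by simp
    moreover have "bang E (src E e) \<cdot> h = b" if "h \<in> Hom E W (src E e)" for h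
      using One_eq[OF cmp_Hom[OF that bang_Hom] b] HomD[OF that] by simp
    moreover have "u = v" if "u \<in> Hom E W (src E e)" "v \<in> Hom E W (src E e)" "e \<cdot> u = e \<cdot> v" for u v
      using monicD[OF m that] .
    ultimately show ?thesis
      by metis
  qed
  then have "is_pullback E e (bang E (src E e)) r (true E)"
    using R T eH bang_Hom[OF HomD(4)[OF eH]] re by (simp add: is_pullback_def)
  then show ?thesis
    using Omega_classifies[OF m] char_map_props[OF m] r HomD[OF eH] by metis
qed

text \<open>Predicates that are true at the same generalized elements have the same extent, and each
  is the classifying map of its extent. This is how equations between truth values are proved from
  forcing conditions.\<close>

lemma Omega_ext:
  assumes r: "r \<in> Hom E X (Omega E)" and s: "s \<in> Hom E X (Omega E)"
    and rs: "\<And>W w. w \<in> Hom E W X \<Longrightarrow> r \<cdot> w = true_at E W \<longleftrightarrow> s \<cdot> w = true_at E W"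
  shows "r = s"
proof -
  obtain e where e: "is_equalizer E e r (true_at E X)"
    using truth_equalizer_exists[OF r] .
  have eH: "e \<in> Hom E (src E e) X" and tH: "true_at E X \<in> Hom E X (Omega E)"
    using e HomD[OF r] true_at_Hom by (auto simp: is_equalizer_def)
  have "s \<cdot> e = true_at E X \<cdot> e"
    using e rs[OF eH] true_at_cmp[OF eH] by (simp add: is_equalizer_def)
  moreover have "\<exists>!h. h \<in> Hom E W (src E e) \<and> e \<cdot> h = a"
    if a: "a \<in> Hom E W X" and "s \<cdot> a = true_at E X \<cdot> a" for W a
  proof -
    have "r \<cdot> a = true_at E X \<cdot> a"
      using that rs[OF a] true_at_cmp[OF a] by simp
    then show ?thesis
      using e a HomD[OF r] unfolding is_equalizer_def by blast
  qed
  ultimately have "is_equalizer E e s (true_at E X)"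
    using HomD[OF s] eH tH by (simp add: is_equalizer_def)
  then show ?thesis
    using truth_equalizer_char_map[OF r e] truth_equalizer_char_map[OF s] by simp
qed

section \<open>Conjunction and implication at generalized elements\<close>

lemma and_Omega_Hom: "and_Omega E \<in> Hom E (Prd E (Omega E) (Omega E)) (Omega E)"
  using char_map_props(1)[OF monic_from_One] pair_props(1)[OF true_Hom true_Hom] HomD
  unfolding and_Omega_def by metis

text \<open>Conjunction classifies a point of \<open>\<Omega> \<times> \<Omega>\<close>. An arrow
  from \<open>W\<close> factors through that point only along \<open>bang E W\<close>, so it must be
  the pair of constant truths.\<close>

lemma and_Omega_true_iff:
  assumes a: "a \<in> Hom E W (Omega E)" and b: "b \<in> Hom E W (Omega E)"
  shows "and_Omega E \<cdot> pair E a b = true_at E W \<longleftrightarrow> a = true_at E W \<and> b = true_at E W"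
proof -
  note tt = pair_props(1)[OF true_Hom true_Hom] and ab = pair_props[OF a b]
  have "and_Omega E \<cdot> pair E a b = true_at E W \<longleftrightarrow>
      (\<exists>h. h \<in> Hom E W (One E) \<and> pair E (true E) (true E) \<cdot> h = pair E a b)"
    using char_map_true_iff[OF monic_from_One[OF tt], of "pair E a b" W] ab HomD[OF tt]
    by (simp add: and_Omega_def)
  also have "\<dots> \<longleftrightarrow> pair E (true_at E W) (true_at E W) = pair E a b"
    using pair_cmp[OF true_Hom true_Hom] true_cmp bang_Hom HomD(4)[OF a] by metis
  also have "\<dots> \<longleftrightarrow> a = true_at E W \<and> b = true_at E W"
    using ab pair_props[OF true_at_Hom true_at_Hom] HomD(4)[OF a] by metis
  finally show ?thesis .
qed

lemma imp_Omega_equalizer: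
  "is_equalizer E (equalizer E (and_Omega E) (Pr1 E (Omega E) (Omega E)))
    (and_Omega E) (Pr1 E (Omega E) (Omega E))"
  unfolding equalizer_def
  using someI_ex[OF equalizer_exists[OF finite_limits and_Omega_Hom Pr1_Hom]] Omega_Obj by blast

lemma imp_Omega_Hom: "imp_Omega E \<in> Hom E (Prd E (Omega E) (Omega E)) (Omega E)"
proof -
  note eq = imp_Omega_equalizer
  have "tgt E (equalizer E (and_Omega E) (Pr1 E (Omega E) (Omega E))) = Prd E (Omega E) (Omega E)"
    using eq HomD[OF and_Omega_Hom] by (simp add: is_equalizer_def Hom_def)
  then show ?thesis
    using char_map_props(1)[OF equalizer_monic[OF eq]] by (simp add: imp_Omega_def)
qed

lemma imp_Omega_true_iff:
  assumes a: "a \<in> Hom E W (Omega E)" and b: "b \<in> Hom E W (Omega E)"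
  shows "imp_Omega E \<cdot> pair E a b = true_at E W \<longleftrightarrow> and_Omega E \<cdot> pair E a b = a"
proof -
  note eq = imp_Omega_equalizer and ab = pair_props[OF a b]
  have s: "src E (and_Omega E) = Prd E (Omega E) (Omega E)"
    using HomD[OF and_Omega_Hom] by simp
  then have "tgt E (equalizer E (and_Omega E) (Pr1 E (Omega E) (Omega E))) = Prd E (Omega E) (Omega E)"
    using eq by (simp add: is_equalizer_def Hom_def)
  then show ?thesis
    using char_map_true_iff[OF equalizer_monic[OF eq], of "pair E a b" W]
      equalizer_factor_iff[OF eq, of "pair E a b" W] ab s
    by (simp add: imp_Omega_def)
qed

text \<open>The Kripke-Joyal clause for implication. The premise ranges over all stages
  \<open>w\<close>, since that is what \<open>Omega_ext\<close> needs to show that the conjunction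
  of \<open>a\<close> and \<open>b\<close> equals \<open>a\<close>.\<close>

lemma imp_Omega_trueI:
  assumes a: "a \<in> Hom E X (Omega E)" and b: "b \<in> Hom E X (Omega E)"
    and ab: "\<And>W w. w \<in> Hom E W X \<Longrightarrow> a \<cdot> w = true_at E W \<Longrightarrow> b \<cdot> w = true_at E W"
  shows "imp_Omega E \<cdot> pair E a b = true_at E X"
proof -
  note P = pair_props(1)[OF a b]
  have "and_Omega E \<cdot> pair E a b = a"
  proof (rule Omega_ext[OF cmp_Hom[OF P and_Omega_Hom] a])
    fix W w
    assume w: "w \<in> Hom E W X"
    show "(and_Omega E \<cdot> pair E a b) \<cdot> w = true_at E W \<longleftrightarrow> a \<cdot> w = true_at E W"
      using cmp_assoc[OF w P and_Omega_Hom] pair_cmp[OF a b w]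
        and_Omega_true_iff[OF cmp_Hom[OF w a] cmp_Hom[OF w b]] ab[OF w] by auto
  qed
  then show ?thesis
    using imp_Omega_true_iff[OF a b] by simp
qed

lemma imp_Omega_trueD:
  assumes a: "a \<in> Hom E X (Omega E)" and b: "b \<in> Hom E X (Omega E)" and w: "w \<in> Hom E W X"
    and imp: "(imp_Omega E \<cdot> pair E a b) \<cdot> w = true_at E W" and aw: "a \<cdot> w = true_at E W"
  shows "b \<cdot> w = true_at E W"
proof -
  note aw' = cmp_Hom[OF w a] and bw' = cmp_Hom[OF w b]
  have "imp_Omega E \<cdot> pair E (a \<cdot> w) (b \<cdot> w) = true_at E W"
    using imp cmp_assoc[OF w pair_props(1)[OF a b] imp_Omega_Hom] pair_cmp[OF a b w] by simp
  then have "and_Omega E \<cdot> pair E (a \<cdot> w) (b \<cdot> w) = true_at E W"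
    using imp_Omega_true_iff[OF aw' bw'] aw by simp
  then show ?thesis
    using and_Omega_true_iff[OF aw' bw'] by simp
qed

section \<open>Exponential transposes and universal quantification\<close>

lemma curry_arr_props:
  assumes "W \<in> Obj E" "A \<in> Obj E" "f \<in> Hom E (Prd E W A) B"
  shows "curry_arr E W A B f \<in> Hom E W (Exp E A B)"
    and "Ev E A B \<cdot> times_id E (curry_arr E W A B f) A = f"
  using theI'[OF Exp_universal[OF assms(2) HomD(5)[OF assms(3)] assms(1,3)]]
  by (auto simp: curry_arr_def)

text \<open>The quantifier classifies exactly this name, which is monic because its source is
  terminal. The claim is the commutativity of the classifying square.\<close>

lemma all_Omega_true:
  assumes "A \<in> Obj E"
  shows "all_Omega E A \<cdot> curry_arr E (One E) A (Omega E) (true_at E (Prd E (One E) A)) =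
    true_at E (One E)"
proof -
  note c = curry_arr_props(1)[OF One_Obj assms true_at_Hom[OF Prd_Obj[OF One_Obj assms]]]
  show ?thesis
    using char_map_props(2)[OF monic_from_One[OF c]] HomD[OF c]
    by (simp add: all_Omega_def is_pullback_def true_at_def)
qed

text \<open>\<open>U\<close> is the extent of the closed formula "for all \<open>x : M\<close>,
  \<open>\<phi> x\<close>". It is built as the equalizer of the names of \<open>\<phi>\<close> and
  of truth in the exponential of \<open>\<Omega>\<close> by \<open>M\<close>.\<close>

lemma forall_subterminal:
  assumes \<phi>: "\<phi> \<in> Hom E M (Omega E)"
  obtains U where "U \<in> Obj E"
    and "\<And>W. W \<in> Obj E \<Longrightarrow>
      (\<exists>h. h \<in> Hom E W U) \<longleftrightarrow> \<phi> \<cdot> Pr2 E W M = true_at E (Prd E W M)"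
proof -
  have M: "M \<in> Obj E"
    using HomD[OF \<phi>] by simp
  let ?P = "Prd E (One E) M"
  let ?n = "curry_arr E (One E) M (Omega E)"
  note P = Prd_Obj[OF One_Obj M] and pr = Pr2_Hom[OF One_Obj M]
  note \<phi>p = cmp_Hom[OF pr \<phi>]
  note n1 = curry_arr_props[OF One_Obj M \<phi>p]
  note n2 = curry_arr_props[OF One_Obj M true_at_Hom[OF P]]
  obtain e where e: "is_equalizer E e (?n (\<phi> \<cdot> Pr2 E (One E) M)) (?n (true_at E ?P))"
    using equalizer_exists[OF finite_limits n1(1) n2(1)] by blast
  have eH: "e \<in> Hom E (src E e) (One E)"
    using e HomD[OF n1(1)] by (simp add: is_equalizer_def)
  have "(\<exists>h. h \<in> Hom E W (src E e)) \<longleftrightarrow> \<phi> \<cdot> Pr2 E W M = true_at E (Prd E W M)"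
    if W: "W \<in> Obj E" for W
  proof -
    note b = bang_Hom[OF W] and ev = Ev_Hom[OF M Omega_Obj]
    note tb = times_id_props[OF b M]
    \<comment> \<open>Restricting a name along \<open>bang E W\<close> reindexes the predicate it
      transposes. With this, \<open>k1\<close> and \<open>k2\<close> compute the transposes of the
      two names at stage \<open>W\<close>.\<close>
    have ev_cmp: "Ev E M (Omega E) \<cdot> times_id E (k \<cdot> bang E W) M =
        (Ev E M (Omega E) \<cdot> times_id E k M) \<cdot> times_id E (bang E W) M"
      if k: "k \<in> Hom E (One E) (Exp E M (Omega E))" for k
      using times_id_cmp[OF b k M] cmp_assoc[OF tb(1) times_id_props(1)[OF k M] ev] by simp
    have k1: "Ev E M (Omega E) \<cdot> times_id E (?n (\<phi> \<cdot> Pr2 E (One E) M) \<cdot> bang E W) M = \<phi> \<cdot> Pr2 E W M"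
      using ev_cmp[OF n1(1)] n1(2) cmp_assoc[OF tb(1) pr \<phi>] tb(3) by simp
    have k2: "Ev E M (Omega E) \<cdot> times_id E (?n (true_at E ?P) \<cdot> bang E W) M =
        true_at E (Prd E W M)"
      using ev_cmp[OF n2(1)] n2(2) true_at_cmp[OF tb(1)] by simp
    \<comment> \<open>The equation for \<open>e \<cdot> h\<close> holds automatically, as both sides
      are arrows into the terminal object.\<close>
    have "(\<exists>h. h \<in> Hom E W (src E e)) \<longleftrightarrow> (\<exists>h. h \<in> Hom E W (src E e) \<and> e \<cdot> h = bang E W)"
      using cmp_Hom[OF _ eH] One_eq[OF _ b] by blast
    also have "\<dots> \<longleftrightarrow> ?n (\<phi> \<cdot> Pr2 E (One E) M) \<cdot> bang E W = ?n (true_at E ?P) \<cdot> bang E W"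
      using equalizer_factor_iff[OF e, of "bang E W" W] b HomD[OF n1(1)] by simp
    \<comment> \<open>Transposition is injective, so the two names agree at \<open>W\<close> exactly
      when the predicates in \<open>k1\<close> and \<open>k2\<close> agree.\<close>
    also have "\<dots> \<longleftrightarrow> \<phi> \<cdot> Pr2 E W M = true_at E (Prd E W M)"
      using Exp_universal[OF M Omega_Obj W cmp_Hom[OF Pr2_Hom[OF W M] \<phi>]]
        cmp_Hom[OF b n1(1)] cmp_Hom[OF b n2(1)] k1 k2 by metis
    finally show ?thesis .
  qed
  then show thesis
    using that HomD(4)[OF eH] by blast
qed

end


section \<open>Loeb induction\<close>

locale guarded_topos = topos E + guarded_model E Lo La nxt
  for E :: "('o, 'a, 'r) topos_scheme" (structure) and Lo La nxt
begin

text \<open>\<open>true E\<close> is split by \<open>bang E (Omega E)\<close>, and functors preserve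
  splittings. Hence the pullback along \<open>nxt (Omega E)\<close> that defines
  \<open>\<rhd>true\<close> exists and is monic.\<close>

lemma La_bang_true: "La (bang E (Omega E)) \<cdot> La (true E) = idt E (Lo (One E))"
proof -
  note b = bang_Hom[OF Omega_Obj]
  have "bang E (Omega E) \<cdot> true E = idt E (One E)"
    using One_eq[OF cmp_Hom[OF true_Hom b] idt_Hom[OF One_Obj]] .
  then show ?thesis
    using L.Fa_cmp[OF true_Hom b] L.Fa_idt[OF One_Obj] by simp
qed

lemma later_sub_true: "\<exists>k. is_pullback E (later_sub E La nxt (true E)) k (nxt (Omega E)) (La (true E))"
proof -
  have "\<exists>n k. is_pullback E n k (nxt (Omega E)) (La (true E))"
    using pullback_of_split_monic[OF finite_limits nxt_Hom[OF Omega_Obj] L.Fa_Hom[OF true_Hom]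
        L.Fa_Hom[OF bang_Hom[OF Omega_Obj]] La_bang_true] .
  then show ?thesis
    using someI_ex[of "\<lambda>n. \<exists>k. is_pullback E n k (nxt (Omega E)) (La (true E))"] HomD[OF true_Hom]
    by (simp add: later_sub_def)
qed

text \<open>The forcing clause for \<open>\<rhd>\<close>: the classified subobject is a pullback of
  \<open>La (true E)\<close>, so \<open>\<rhd>w\<close> is true when
  \<open>nxt (Omega E) \<cdot> w\<close> factors through \<open>La (true E)\<close>.\<close>

lemma later_Omega_props:
  shows later_Omega_Hom: "later_Omega E La nxt \<in> Hom E (Omega E) (Omega E)"
    and later_Omega_true_iff: "w \<in> Hom E W (Omega E) \<Longrightarrow> later_Omega E La nxt \<cdot> w = true_at E W \<longleftrightarrow>
      (\<exists>b. b \<in> Hom E W (Lo (One E)) \<and> nxt (Omega E) \<cdot> w = La (true E) \<cdot> b)"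
proof -
  obtain k where pb: "is_pullback E (later_sub E La nxt (true E)) k (nxt (Omega E)) (La (true E))"
    using later_sub_true by blast
  have m: "monic E (later_sub E La nxt (true E))"
    using pullback_monic[OF pb split_monic[OF L.Fa_Hom[OF true_Hom]
        L.Fa_Hom[OF bang_Hom[OF Omega_Obj]] La_bang_true]] .
  have s: "src E (nxt (Omega E)) = Omega E" "src E (La (true E)) = Lo (One E)"
    using HomD[OF nxt_Hom[OF Omega_Obj]] HomD[OF L.Fa_Hom[OF true_Hom]] by auto
  then have t: "tgt E (later_sub E La nxt (true E)) = Omega E"
    using pb by (simp add: is_pullback_def Hom_def)
  show "later_Omega E La nxt \<in> Hom E (Omega E) (Omega E)"
    using char_map_props(1)[OF m] t by (simp add: later_Omega_def)
  show "later_Omega E La nxt \<cdot> w = true_at E W \<longleftrightarrow>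
      (\<exists>b. b \<in> Hom E W (Lo (One E)) \<and> nxt (Omega E) \<cdot> w = La (true E) \<cdot> b)"
    if "w \<in> Hom E W (Omega E)"
    using char_map_true_iff[OF m, of w W] pullback_factor_iff[OF pb, of w W] that s t
    by (simp add: later_Omega_def)
qed

text \<open>Applying \<open>La\<close> to the hypothesis gives a factorization through
  \<open>La (true E)\<close> over \<open>Lo (Prd E U M)\<close>. It remains to move it to
  \<open>Prd E (Lo U) M\<close>, delaying only the component in \<open>M\<close> by
  \<open>nxt M\<close>.\<close>

lemma later_forall:
  assumes \<phi>: "\<phi> \<in> Hom E M (Omega E)" and U: "U \<in> Obj E"
    and true: "\<phi> \<cdot> Pr2 E U M = true_at E (Prd E U M)"
  shows "later_Omega E La nxt \<cdot> (\<phi> \<cdot> Pr2 E (Lo U) M) = true_at E (Prd E (Lo U) M)"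
proof -
  have M: "M \<in> Obj E"
    using HomD[OF \<phi>] by simp
  note LU = L.Fo_Obj[OF U]
  note p1 = Pr1_Hom[OF LU M] and p2 = Pr2_Hom[OF LU M] and pU = Pr2_Hom[OF U M]
  note np2 = cmp_Hom[OF p2 nxt_Hom[OF M]] and bU = bang_Hom[OF Prd_Obj[OF U M]]
  \<comment> \<open>Under the identification of \<open>Lo (Prd E U M)\<close> with a product of
    \<open>Lo U\<close> and \<open>Lo M\<close>, \<open>c\<close> is the identity of
    \<open>Lo U\<close> times \<open>nxt M\<close>.\<close>
  obtain c where c: "c \<in> Hom E (Prd E (Lo U) M) (Lo (Prd E U M))"
    and c2: "La (Pr2 E U M) \<cdot> c = nxt M \<cdot> Pr2 E (Lo U) M"
    using functor_preserves_pairing[OF L.cat_functor_axioms later_limits U M p1 np2] by blast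
  have "nxt (Omega E) \<cdot> (\<phi> \<cdot> Pr2 E (Lo U) M) = La \<phi> \<cdot> (nxt M \<cdot> Pr2 E (Lo U) M)"
    using cmp_assoc[OF p2 \<phi> nxt_Hom[OF Omega_Obj]] nxt_natural[OF \<phi>]
      cmp_assoc[OF p2 nxt_Hom[OF M] L.Fa_Hom[OF \<phi>]] by simp
  also have "\<dots> = La (\<phi> \<cdot> Pr2 E U M) \<cdot> c"
    using c2 cmp_assoc[OF c L.Fa_Hom[OF pU] L.Fa_Hom[OF \<phi>]] L.Fa_cmp[OF pU \<phi>] by simp
  also have "\<dots> = La (true E) \<cdot> (La (bang E (Prd E U M)) \<cdot> c)"
    unfolding true true_at_def
    using cmp_assoc[OF c L.Fa_Hom[OF bU] L.Fa_Hom[OF true_Hom]] L.Fa_cmp[OF bU true_Hom] by simp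
  finally show ?thesis
    using later_Omega_true_iff[OF cmp_Hom[OF p2 \<phi>]] cmp_Hom[OF c L.Fa_Hom[OF bU]] by blast
qed

lemma external_loeb:
  assumes \<phi>: "\<phi> \<in> Hom E M (Omega E)"
    and step: "\<And>W w. w \<in> Hom E W M \<Longrightarrow> later_Omega E La nxt \<cdot> (\<phi> \<cdot> w) = true_at E W \<Longrightarrow>
      \<phi> \<cdot> w = true_at E W"
  shows "\<phi> = true_at E M"
proof -
  have M: "M \<in> Obj E"
    using HomD[OF \<phi>] by simp
  obtain U where U: "U \<in> Obj E" and U_iff: "\<And>W. W \<in> Obj E \<Longrightarrow>
      (\<exists>h. h \<in> Hom E W U) \<longleftrightarrow> \<phi> \<cdot> Pr2 E W M = true_at E (Prd E W M)"
    using forall_subterminal[OF \<phi>] by blast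
  \<comment> \<open>The identity of \<open>U\<close> is the generic witness that
    \<open>\<phi>\<close> holds throughout \<open>M\<close> at stage \<open>U\<close>.\<close>
  have "\<phi> \<cdot> Pr2 E U M = true_at E (Prd E U M)"
    using U_iff[OF U] idt_Hom[OF U] by blast
  then have "\<phi> \<cdot> Pr2 E (Lo U) M = true_at E (Prd E (Lo U) M)"
    using step[OF Pr2_Hom[OF L.Fo_Obj[OF U] M]] later_forall[OF \<phi> U] by blast
  then obtain f where "f \<in> Hom E (Lo U) U"
    using U_iff[OF L.Fo_Obj[OF U]] by blast
  then have "\<exists>h. h \<in> Hom E (One E) U"
    using guarded_fixpoint[OF U] by blast
  then have true: "\<phi> \<cdot> Pr2 E (One E) M = true_at E (Prd E (One E) M)"
    using U_iff[OF One_Obj] by simp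
  \<comment> \<open>This section of the second projection carries truth on
    \<open>Prd E (One E) M\<close> back to \<open>M\<close>.\<close>
  note s = pair_props[OF bang_Hom[OF M] idt_Hom[OF M]]
  show ?thesis
    using cmp_assoc[OF s(1) Pr2_Hom[OF One_Obj M] \<phi>] true s(3) cmp_idt[OF \<phi>] true_at_cmp[OF s(1)]
    by simp
qed

text \<open>By the clause for implication, it suffices to work at a stage \<open>m\<close> where the
  inner implication holds. Its truth persists along every further \<open>w\<close>, and this is the
  step hypothesis of \<open>external_loeb\<close> for the predicate
  \<open>p \<cdot> m\<close>.\<close>

lemma loeb_implication:
  assumes p: "p \<in> Hom E X (Omega E)"
  shows "imp_Omega E \<cdot> pair E (imp_Omega E \<cdot> pair E (later_Omega E La nxt \<cdot> p) p) p = true_at E X"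
proof -
  let ?q = "imp_Omega E \<cdot> pair E (later_Omega E La nxt \<cdot> p) p"
  note Lp = cmp_Hom[OF p later_Omega_Hom]
  have q: "?q \<in> Hom E X (Omega E)"
    using cmp_Hom[OF pair_props(1)[OF Lp p] imp_Omega_Hom] .
  show ?thesis
  proof (rule imp_Omega_trueI[OF q p])
    fix M m
    assume m: "m \<in> Hom E M X" and qm: "?q \<cdot> m = true_at E M"
    show "p \<cdot> m = true_at E M"
    proof (rule external_loeb[OF cmp_Hom[OF m p]])
      fix W w
      assume w: "w \<in> Hom E W M"
        and L: "later_Omega E La nxt \<cdot> ((p \<cdot> m) \<cdot> w) = true_at E W"
      note mw = cmp_Hom[OF w m]
      have pmw: "(p \<cdot> m) \<cdot> w = p \<cdot> (m \<cdot> w)"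
        using cmp_assoc[OF w m p] .
      have "?q \<cdot> (m \<cdot> w) = true_at E W"
        using cmp_assoc[OF w m q] qm true_at_cmp[OF w] by simp
      moreover have "(later_Omega E La nxt \<cdot> p) \<cdot> (m \<cdot> w) = true_at E W"
        using cmp_assoc[OF mw p later_Omega_Hom] L pmw by simp
      ultimately show "(p \<cdot> m) \<cdot> w = true_at E W"
        using imp_Omega_trueD[OF Lp p mw] pmw by simp
    qed
  qed
qed

end

theorem theorem6p8:
  fixes E :: "('o, 'a) topos"
    and Lo :: "'o \<Rightarrow> 'o" and La :: "'a \<Rightarrow> 'a" and nxt :: "'o \<Rightarrow> 'a"
  assumes "topos E" and "guarded_model E Lo La nxt"
  shows "valid E []
    (All (Omega E) (Imp (Imp (App (later_Omega E La nxt) (Var 0)) (Var 0)) (Var 0)))"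
proof -
  interpret guarded_topos E Lo La nxt
    using assms by (rule guarded_topos.intro)
  show ?thesis
    \<comment> \<open>In the context with the single variable of type \<open>\<Omega>\<close>,
      \<open>Var 0\<close> denotes the second projection, so \<open>p\<close> is taken to be that
      generic truth value. The body of the quantifier is then constantly true.\<close>
    using loeb_implication[OF Pr2_Hom[OF One_Obj Omega_Obj]] all_Omega_true[OF Omega_Obj]
    by (simp add: valid_def)
qed

end
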